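(* Let $M\ge 1$ and $b\ge 1$ be integers, let $\mu_P,\mu_{Nc},\mu_{Ns}>0$, set $\zeta=\mu_{Ns}/\mu_{Nc}$, and let $0<\gamma<1$. Suppose that $\lambda>0$ and positive reals $\alpha_{Pc}$, $\alpha_{Nc}$, $\alpha^-_{Ps_i}$ ($1\le i\le b-1$), $\alpha^+_{Ns_i}$ ($1\le i\le b$), $\rho_P,\rho_{Nc},\rho_{Ns}$ satisfy the traffic equations of the computation sharding model with single-destination transactions: $$\alpha_{Pc}=\frac1M\,\rho_{Nc}\,\mu_{Nc}+\rho_{Ns}\,\mu_{Ns}\cdot\frac1M\cdot\frac{M-1}{M}\cdot\frac{\lambda}{\alpha_{Pc}},\qquad \alpha_{Nc}=M\lambda,$$ $$\alpha^-_{Ps_i}=\frac1M\,\alpha^+_{Ns_{i+1}}\ (1\le i\le b-1),\qquad \alpha^+_{Ns_b}=M\rho_P\,\mu_P,\qquad \alpha^+_{Ns_i}=M\rho_P\,\alpha^-_{Ps_i}\ (1\le i\le b-1),$$ where $$\rho_P=\frac{\alpha_{Pc}}{\mu_P+\sum_{i=1}^{b-1}\alpha^-_{Ps_i}},\qquad \rho_{Nc}=\frac{\alpha_{Nc}}{\mu_{Nc}},\qquad \rho_{Ns}=\frac{\sum_{i=1}^{b}\alpha^+_{Ns_i}}{\mu_{Ns}},$$ and let $\rho_N=\rho_{Nc}+\rho_{Ns}$. Then, if $\rho_P\ne1$, $$\lambda=\frac{\rho_P(1-\rho_P^{\,b})}{1-\rho_P}\cdot\frac{\mu_P}{1+\frac{M-1}{M}},$$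 and the constraint $\rho_N<\gamma$ on the load of the shared network queue is equivalent to the following bound on the system throughput $M\lambda$: $$M\lambda<\frac{\gamma\,\mu_{Ns}}{\zeta+1+\frac{M-1}{M}}.$$
   Context: In the computation sharding model there is one network queue $N$ shared by $M$ identical consensus queues $P$: every piece of information is broadcast to and stored by all nodes, and only block production is divided among shards. $N$ has service rate $\mu_{Nc}$ for transactions (class $c$) and $\mu_{Ns}$ for block components (class $s$); each consensus queue has service rate $\mu_P$; a block contains at most $b$ transactions/receipts. $\lambda$ is the rate of newly issued transactions per shard, so $M\lambda$ is the system throughput. $\alpha_{Pc},\alpha_{Nc}$ are the arrival rates of class $c$ customers to a typical consensus queue and to $N$; $\alpha^-_{Ps_i}$ is the arrival rate of the negative signal $s_i^-$ to a typical consensus queue and $\alpha^+_{Ns_i}$ the arrival rate of the positive signal $s_i^+$ to $N$; $\rho_P,\rho_{Nc},\rho_{Ns}$ are utilization factors and $\rho_N$ is the total utilization of the network queue. The constant $\gamma<1$ is a limit on $\rho_N$ imposed to keep the fork rate acceptable. By symmetry, equations are written for one typical consensus queue. *)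

theory Defs
  imports Complex_Main
begin

end

theory Submission
  imports Defs
begin

text \<open>Since \<open>\<rho>\<^sub>N\<^sub>s \<mu>\<^sub>N\<^sub>s = \<Sum>\<^sub>i \<alpha>\<^sup>+\<^sub>i = M \<rho>\<^sub>P (\<mu>\<^sub>P + \<Sum>\<^sub>i \<alpha>\<^sup>-\<^sub>i) = M \<alpha>\<^sub>P\<^sub>c\<close>, the factor
  \<open>\<alpha>\<^sub>P\<^sub>c\<close> cancels in the first traffic equation, which collapses to \<open>\<alpha>\<^sub>P\<^sub>c = \<lambda> (1 + (M - 1) / M)\<close>. Hence
  \<open>\<rho>\<^sub>N\<close> is linear in \<open>\<lambda>\<close>, while the signal rates form a geometric progression with ratio
  \<open>\<rho>\<^sub>P\<close>, whose sum is \<open>M \<alpha>\<^sub>P\<^sub>c\<close>.\<close>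

text \<open>Read downwards from \<open>n\<close>, the terms are \<open>a n\<close> times successive
  powers of \<open>r\<close>, so multiplying by \<open>1 - r\<close> telescopes the sum. Avoiding
  division keeps \<open>r = 1\<close> and general commutative rings in scope.\<close>

lemma sum_backward_geometric:
  fixes a :: "nat \<Rightarrow> 'a::comm_ring_1"
  assumes "\<And>i. i \<in> {1..<n} \<Longrightarrow> a i = r * a (Suc i)"
  shows "(1 - r) * (\<Sum>i=1..n. a i) = a n * (1 - r ^ n)"
  using assms
proof (induction n)
  case (Suc n)
  show ?case
  \<comment> \<open>The recurrence starts at index 1, so it says nothing about
    \<open>a 0\<close>.\<close>
  proof (cases "n = 0")
    case False
    have "(1 - r) * (\<Sum>i=1..n. a i) = a n * (1 - r ^ n)"
      using Suc by simp
    moreover have "a n = r * a (Suc n)"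
      using Suc.prems False by simp
    ultimately show ?thesis
      by (simp add: algebra_simps)
  qed (simp add: algebra_simps)
qed simp

theorem mainTheorem3:
  fixes M b :: nat
    and \<mu>_P \<mu>_Nc \<mu>_Ns \<zeta> \<gamma> :: real
    and lam \<alpha>_Pc \<alpha>_Nc :: real
    and \<alpha>_Ps_minus \<alpha>_Ns_plus :: "nat \<Rightarrow> real"
    and \<rho>_P \<rho>_Nc \<rho>_Ns \<rho>_N :: real
  assumes "M \<ge> 1" and "b \<ge> 1"
    and "\<mu>_P > 0" and "\<mu>_Nc > 0" and "\<mu>_Ns > 0"
    and "\<zeta> = \<mu>_Ns / \<mu>_Nc"
    and "0 < \<gamma>" and "\<gamma> < 1"
    and "lam > 0" and "\<alpha>_Pc > 0" and "\<alpha>_Nc > 0"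
    and "\<And>i. i \<in> {1..b-1} \<Longrightarrow> \<alpha>_Ps_minus i > 0"
    and "\<And>i. i \<in> {1..b} \<Longrightarrow> \<alpha>_Ns_plus i > 0"
    and "\<rho>_P > 0" and "\<rho>_Nc > 0" and "\<rho>_Ns > 0"
    and "\<alpha>_Pc = 1 / real M * \<rho>_Nc * \<mu>_Nc
           + \<rho>_Ns * \<mu>_Ns * (1 / real M) * ((real M - 1) / real M) * (lam / \<alpha>_Pc)"
    and "\<alpha>_Nc = real M * lam"
    and "\<And>i. i \<in> {1..b-1} \<Longrightarrow> \<alpha>_Ps_minus i = 1 / real M * \<alpha>_Ns_plus (i + 1)"
    and "\<alpha>_Ns_plus b = real M * \<rho>_P * \<mu>_P"
    and "\<And>i. i \<in> {1..b-1} \<Longrightarrow> \<alpha>_Ns_plus i = real M * \<rho>_P * \<alpha>_Ps_minus i"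
    and "\<rho>_P = \<alpha>_Pc / (\<mu>_P + (\<Sum>i=1..b-1. \<alpha>_Ps_minus i))"
    and "\<rho>_Nc = \<alpha>_Nc / \<mu>_Nc"
    and "\<rho>_Ns = (\<Sum>i=1..b. \<alpha>_Ns_plus i) / \<mu>_Ns"
    and "\<rho>_N = \<rho>_Nc + \<rho>_Ns"
  shows "(\<rho>_P \<noteq> 1 \<longrightarrow>
            lam = \<rho>_P * (1 - \<rho>_P ^ b) / (1 - \<rho>_P) * (\<mu>_P / (1 + (real M - 1) / real M)))
       \<and> (\<rho>_N < \<gamma> \<longleftrightarrow>
            real M * lam < \<gamma> * \<mu>_Ns / (\<zeta> + 1 + (real M - 1) / real M))"
proof -
  define k where "k = 1 + (real M - 1) / real M"
  define A where "A = (\<Sum>i=1..b-1. \<alpha>_Ps_minus i)"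
  define S where "S = (\<Sum>i=1..b. \<alpha>_Ns_plus i)"
  have M: "real M > 0" and k: "k > 0"
    using assms(1) by (simp_all add: k_def add_pos_nonneg)
  \<comment> \<open>Makes the denominator \<open>\<mu>_P + A\<close> of \<open>\<rho>_P\<close>
    positive, so that it can be cleared.\<close>
  have A: "A \<ge> 0"
    unfolding A_def using assms(12) by (intro sum_nonneg) (simp add: less_imp_le)
  \<comment> \<open>The top signal is split off because its rate is driven by \<open>\<mu>_P\<close>
    rather than by a negative signal.\<close>
  have "{1..b} = insert b {1..b-1}" "b \<notin> {1..b-1}"
    using assms(2) by auto
  then have "S = \<alpha>_Ns_plus b + (\<Sum>i=1..b-1. \<alpha>_Ns_plus i)"
    unfolding S_def by simp
  also have "(\<Sum>i=1..b-1. \<alpha>_Ns_plus i) = real M * \<rho>_P * A"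
    unfolding A_def sum_distrib_left using assms(21) by (intro sum.cong) auto
  finally have "S = real M * (\<rho>_P * (\<mu>_P + A))"
    using assms(20) by (simp add: algebra_simps)
  moreover have "\<rho>_P * (\<mu>_P + A) = \<alpha>_Pc"
    using assms(22)[folded A_def] A assms(3) by simp
  ultimately have S: "S = real M * \<alpha>_Pc"
    by simp
  have Ns: "\<rho>_Ns * \<mu>_Ns = real M * \<alpha>_Pc" and Nc: "\<rho>_Nc * \<mu>_Nc = real M * lam"
    using assms(4,5,18,23,24) S by (simp_all add: S_def)
  have "\<alpha>_Pc = 1 / real M * (\<rho>_Nc * \<mu>_Nc)
      + \<rho>_Ns * \<mu>_Ns * (1 / real M) * ((real M - 1) / real M) * (lam / \<alpha>_Pc)"
    using assms(17) by (simp only: mult.assoc)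
  also have "\<dots> = lam * k"
    unfolding Ns Nc k_def using M assms(10) by (simp add: field_simps)
  finally have Pc: "\<alpha>_Pc = lam * k" .

  have "lam = \<rho>_P * (1 - \<rho>_P ^ b) / (1 - \<rho>_P) * (\<mu>_P / k)" if "\<rho>_P \<noteq> 1"
  proof -
    \<comment> \<open>Eliminating the negative signals between the two signal equations cancels
      \<open>M\<close> against \<open>1 / M\<close>.\<close>
    have "\<alpha>_Ns_plus i = \<rho>_P * \<alpha>_Ns_plus (Suc i)" if "i \<in> {1..<b}" for i
    proof -
      have "i \<in> {1..b-1}"
        using that by auto
      then show ?thesis
        using assms(19)[of i] assms(21)[of i] M by simp
    qed
    then have "(1 - \<rho>_P) * S = \<alpha>_Ns_plus b * (1 - \<rho>_P ^ b)"
      unfolding S_def by (rule sum_backward_geometric)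
    \<comment> \<open>Equates the two evaluations of \<open>S\<close>: the geometric one and
      \<open>M * \<alpha>_Pc\<close>.\<close>
    then have "real M * ((1 - \<rho>_P) * (lam * k)) = real M * (\<rho>_P * \<mu>_P * (1 - \<rho>_P ^ b))"
      by (simp add: S Pc assms(20) mult_ac)
    then have "(1 - \<rho>_P) * (lam * k) = \<rho>_P * \<mu>_P * (1 - \<rho>_P ^ b)"
      using M by simp
    then have "lam = \<rho>_P * \<mu>_P * (1 - \<rho>_P ^ b) / ((1 - \<rho>_P) * k)"
      using that k by (simp add: eq_divide_eq mult_ac)
    then show ?thesis
      by (simp add: mult_ac)
  qed
  moreover have "\<rho>_N < \<gamma> \<longleftrightarrow> real M * lam < \<gamma> * \<mu>_Ns / (\<zeta> + k)"
  proof -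
    have "\<zeta> + k > 0"
      using k assms(4-6) by (simp add: add_pos_pos)
    moreover have "\<rho>_N = real M * lam * (\<zeta> + k) / \<mu>_Ns"
    proof -
      \<comment> \<open>The factor \<open>\<zeta>\<close> brings both loads over the common
        denominator \<open>\<mu>_Ns\<close>.\<close>
      have "\<rho>_Nc = real M * lam * \<zeta> / \<mu>_Ns"
        using assms(4-6,18,23) by simp
      moreover have "\<rho>_Ns = real M * lam * k / \<mu>_Ns"
        using assms(5) Ns Pc by (simp add: eq_divide_eq)
      ultimately show ?thesis
        by (simp add: assms(25) distrib_left add_divide_distrib)
    qed
    ultimately show ?thesis
      using assms(5) by (simp add: pos_less_divide_eq pos_divide_less_eq)
  qed
  ultimately show ?thesis
    by (simp add: k_def add.assoc)
qed

end
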